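(* Let $X$ be a complex Banach space, $\alpha>0$ and $T,(T_n)_{n\in\mathbb{N}_0}\subset\mathcal{B}(X)$. Then the following assertions are equivalent: (i) $T_n=\Delta^{-\alpha}\mathcal{T}(n)$ for $n\in\mathbb{N}_0$. (ii) $T_0=I$ and the following functional equation holds: $$T_nT_m=\sum_{u=m}^{n+m}k^{\alpha}(n+m-u)T_u-\sum_{u=0}^{n-1}k^{\alpha}(n+m-u)T_u,\qquad n\ge 1,\ m\in\mathbb{N}_0.$$
   Context: $\mathbb{N}_0=\{0,1,2,\dots\}$; $\mathcal{B}(X)$ is the algebra of bounded linear operators on $X$ and $I$ is the identity. For $\alpha>0$, $k^\alpha(n)=\frac{\Gamma(n+\alpha)}{\Gamma(\alpha)\Gamma(n+1)}$, $n\in\mathbb{N}_0$. For $T\in\mathcal{B}(X)$, $\mathcal{T}(n)=T^n$ (with $T^0=I$), and the Cesàro sum of order $\alpha>0$ of $T$ is $\Delta^{-\alpha}\mathcal{T}(n)=\sum_{j=0}^n k^{\alpha}(n-j)T^j$, $n\in\mathbb{N}_0$.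
   Formalization: In (i), T is not fixed in advance: (i) is read as "there is T in B(X) with T_n equal to its Cesàro sums for all n"; with T fixed, (ii) does not imply (i), e.g. X = C, α = 1, T = 0, T_n = n+1. *)

theory Defs
  imports "HOL-Analysis.Analysis"
begin

text \<open>
  Complex Banach spaces: complete normed spaces with a complex scalar multiplication that extends
  the real one and is compatible with the norm.
\<close>

class complex_banach = banach +
  fixes scaleC :: "complex \<Rightarrow> 'a \<Rightarrow> 'a" (infixr \<open>*\<^sub>C\<close> 75)
  assumes scaleC_add_right: "c *\<^sub>C (x + y) = c *\<^sub>C x + c *\<^sub>C y"
    and scaleC_add_left: "(c + d) *\<^sub>C x = c *\<^sub>C x + d *\<^sub>C x"
    and scaleC_scaleC: "c *\<^sub>C d *\<^sub>C x = (c * d) *\<^sub>C x"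
    and scaleC_of_real: "complex_of_real r *\<^sub>C x = r *\<^sub>R x"
    and norm_scaleC: "norm (c *\<^sub>C x) = cmod c * norm x"

instantiation complex :: complex_banach
begin

definition scaleC_complex :: "complex \<Rightarrow> complex \<Rightarrow> complex" where
  "scaleC_complex c x = c * x"

instance
  by standard (simp_all add: scaleC_complex_def algebra_simps norm_mult scaleR_conv_of_real)

end

text \<open>
  The library type of bounded operators only requires real linearity; \<open>bounded_ops\<close> is the
  algebra of bounded complex-linear operators on the whole space.
\<close>

definition bounded_ops :: "('a::complex_banach \<Rightarrow>\<^sub>L 'a) set" where
  "bounded_ops = {T. \<forall>c x. blinfun_apply T (c *\<^sub>C x) = c *\<^sub>C blinfun_apply T x}"

primrec op_power :: "('a::real_normed_vector \<Rightarrow>\<^sub>L 'a) \<Rightarrow> nat \<Rightarrow> ('a \<Rightarrow>\<^sub>L 'a)" where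
  "op_power T 0 = id_blinfun"
| "op_power T (Suc n) = T o\<^sub>L op_power T n"

definition cesaro_kernel :: "real \<Rightarrow> nat \<Rightarrow> real" where
  "cesaro_kernel \<alpha> n = Gamma (real n + \<alpha>) / (Gamma \<alpha> * Gamma (real n + 1))"

definition cesaro_sum ::
    "real \<Rightarrow> ('a::real_normed_vector \<Rightarrow>\<^sub>L 'a) \<Rightarrow> nat \<Rightarrow> ('a \<Rightarrow>\<^sub>L 'a)" where
  "cesaro_sum \<alpha> T n = (\<Sum>j=0..n. cesaro_kernel \<alpha> (n - j) *\<^sub>R op_power T j)"

end

theory Submission
  imports Defs
begin

text \<open>
  Both assertions amount to \<open>S 0 = I\<close> together with the first-order recursion
  \<open>S (n + 1) = T S n + k (n + 1) I\<close>. The functional equation at \<open>n = 1\<close> is this recursion for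
  \<open>T = S 1 - k 1 I\<close>; conversely, the recursion yields the functional equation by induction on
  \<open>n\<close>, the scalar terms collapsing by the reflection \<open>u \<mapsto> n + m - u\<close>. Of the kernel one only
  uses \<open>k 0 = 1\<close>.
\<close>

lemma cesaro_kernel_0 [simp]: "\<alpha> > 0 \<Longrightarrow> cesaro_kernel \<alpha> 0 = 1"
  by (simp add: cesaro_kernel_def Gamma_real_pos less_imp_neq[symmetric])

lemma scaleC_scaleR_commute:
  fixes x :: "'a::complex_banach"
  shows "c *\<^sub>C (r *\<^sub>R x) = r *\<^sub>R (c *\<^sub>C x)"
  by (metis mult.commute scaleC_of_real scaleC_scaleC)

lemma scaleC_diff_right:
  fixes x y :: "'a::complex_banach"
  shows "c *\<^sub>C (x - y) = c *\<^sub>C x - c *\<^sub>C y"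
  by (metis add_diff_cancel_right' diff_add_cancel scaleC_add_right)

text \<open>Ensures that the operator recovered from \<open>S 1\<close> is again
  complex-linear.\<close>

lemma bounded_ops_diff_scaleR_id:
  assumes "T \<in> bounded_ops"
  shows "T - r *\<^sub>R id_blinfun \<in> bounded_ops"
  using assms
  by (simp add: bounded_ops_def blinfun.diff_left blinfun.scaleR_left scaleC_diff_right
      scaleC_scaleR_commute)

lemma blinfun_compose_id_left [simp]: "id_blinfun o\<^sub>L T = T"
  by (rule blinfun_eqI) simp

interpretation blinfun_compose: bounded_bilinear "(o\<^sub>L)"
  by (rule bounded_bilinear_blinfun_compose)

lemma blinfun_compose_assoc: "(A o\<^sub>L B) o\<^sub>L C = A o\<^sub>L (B o\<^sub>L C)"
  by (rule blinfun_eqI) simp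

lemma cesaro_sum_0: "\<alpha> > 0 \<Longrightarrow> cesaro_sum \<alpha> T 0 = id_blinfun"
  by (simp add: cesaro_sum_def)

text \<open>Split off the term \<open>j = 0\<close>, a multiple of the identity; each remaining
  power contains a factor \<open>T\<close>, and \<open>Suc n - Suc j = n - j\<close> leaves the
  kernel weights unchanged.\<close>

lemma cesaro_sum_Suc:
  "cesaro_sum \<alpha> T (Suc n) = (T o\<^sub>L cesaro_sum \<alpha> T n) + cesaro_kernel \<alpha> (Suc n) *\<^sub>R id_blinfun"
  unfolding cesaro_sum_def sum.atLeast0_atMost_Suc_shift
  by (simp add: blinfun_compose.sum_right blinfun_compose.scaleR_right add.commute)

lemma cesaro_sum_unique:
  assumes "\<alpha> > 0" and "S 0 = id_blinfun"
    and "\<And>n. S (Suc n) = (T o\<^sub>L S n) + cesaro_kernel \<alpha> (Suc n) *\<^sub>R id_blinfun"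
  shows "S n = cesaro_sum \<alpha> T n"
  using assms by (induction n) (simp_all add: cesaro_sum_0 cesaro_sum_Suc)

text \<open>Reflection turns the first sum into one over \<open>v \<le> n\<close>. Its term
  \<open>v = 0\<close> is the right-hand side; putting \<open>v = Suc u\<close> in the rest gives
  the second sum with its factors swapped.\<close>

lemma reflected_convolution_difference:
  fixes k :: "nat \<Rightarrow> real"
  shows "(\<Sum>u=m..n+m. k (n + m - u) * k (Suc u)) - (\<Sum>u<n. k (n + m - u) * k (Suc u))
    = k 0 * k (Suc (n + m))"
proof -
  have "(\<Sum>u=m..n+m. k (n + m - u) * k (Suc u)) = (\<Sum>v\<le>n. k v * k (Suc (n + m) - v))"
    by (rule sum.reindex_bij_witness[of _ "\<lambda>v. n + m - v" "\<lambda>u. n + m - u"])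
      (auto simp: Suc_diff_le)
  also have "\<dots> = k 0 * k (Suc (n + m)) + (\<Sum>u<n. k (n + m - u) * k (Suc u))"
    by (simp add: sum.atMost_shift mult.commute)
  finally show ?thesis by simp
qed

lemma compose_of_recursion:
  fixes S :: "nat \<Rightarrow> ('a::real_normed_vector \<Rightarrow>\<^sub>L 'a)" and k :: "nat \<Rightarrow> real"
  assumes k0: "k 0 = 1" and S0: "S 0 = id_blinfun"
    and S_Suc: "\<And>n. S (Suc n) = (T o\<^sub>L S n) + k (Suc n) *\<^sub>R id_blinfun"
  shows "S n o\<^sub>L S m = (\<Sum>u=m..n+m. k (n + m - u) *\<^sub>R S u) - (\<Sum>u<n. k (n + m - u) *\<^sub>R S u)"
proof (induction n)
  case 0
  then show ?case by (simp add: k0 S0)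
next
  case (Suc n)
  \<comment> \<open>Composing with \<open>T\<close> moves each \<open>S u\<close> to
    \<open>S (Suc u)\<close> at the cost of a scalar multiple of the identity.\<close>
  have shift: "T o\<^sub>L (\<Sum>u\<in>A. k (n + m - u) *\<^sub>R S u) = (\<Sum>u\<in>A. k (n + m - u) *\<^sub>R S (Suc u))
      - (\<Sum>u\<in>A. k (n + m - u) * k (Suc u)) *\<^sub>R id_blinfun" for A
    by (simp add: S_Suc blinfun_compose.sum_right blinfun_compose.scaleR_right scaleR_add_right
        sum.distrib scaleR_sum_left)
  have "S (Suc n) o\<^sub>L S m = (T o\<^sub>L (S n o\<^sub>L S m)) + k (Suc n) *\<^sub>R S m"
    by (simp add: S_Suc blinfun_compose.add_left blinfun_compose.scaleR_left
        blinfun_compose_assoc)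
  \<comment> \<open>The scalars left by the two sums combine to \<open>k (Suc (n + m))\<close>.
    Writing the identity as \<open>S 0\<close> makes this the \<open>u = 0\<close> term of the new
    subtracted sum.\<close>
  also have "\<dots> = (k (Suc n) *\<^sub>R S m + (\<Sum>u=m..n+m. k (n + m - u) *\<^sub>R S (Suc u)))
      - ((\<Sum>u<n. k (n + m - u) *\<^sub>R S (Suc u)) + k (Suc (n + m)) *\<^sub>R S 0)"
    using reflected_convolution_difference[where k=k and n=n and m=m]
    unfolding Suc.IH blinfun_compose.diff_right shift k0 S0 diff_eq_eq
    by (simp add: scaleR_add_left)
  also have "k (Suc n) *\<^sub>R S m + (\<Sum>u=m..n+m. k (n + m - u) *\<^sub>R S (Suc u))
      = (\<Sum>u=m..Suc n+m. k (Suc n + m - u) *\<^sub>R S u)"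
    by (subst (2) sum.atLeast_Suc_atMost) (simp_all add: sum.shift_bounds_cl_Suc_ivl del: sum.cl_ivl_Suc)
  also have "(\<Sum>u<n. k (n + m - u) *\<^sub>R S (Suc u)) + k (Suc (n + m)) *\<^sub>R S 0
      = (\<Sum>u<Suc n. k (Suc n + m - u) *\<^sub>R S u)"
    by (subst sum.lessThan_Suc_shift) simp
  finally show ?case .
qed

theorem theorem3:
  fixes \<alpha> :: real
    and S :: "nat \<Rightarrow> ('a::complex_banach \<Rightarrow>\<^sub>L 'a)"
  assumes "\<alpha> > 0"
    and "\<And>n. S n \<in> bounded_ops"
  shows "(\<exists>T \<in> bounded_ops. \<forall>n. S n = cesaro_sum \<alpha> T n)
    \<longleftrightarrow>
    (S 0 = id_blinfun \<and>
     (\<forall>n\<ge>1. \<forall>m. S n o\<^sub>L S m =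
        (\<Sum>u=m..n+m. cesaro_kernel \<alpha> (n + m - u) *\<^sub>R S u)
        - (\<Sum>u=0..n-1. cesaro_kernel \<alpha> (n + m - u) *\<^sub>R S u)))"
proof
  assume "\<exists>T \<in> bounded_ops. \<forall>n. S n = cesaro_sum \<alpha> T n"
  then obtain T where T: "\<And>n. S n = cesaro_sum \<alpha> T n" by blast
  have S0: "S 0 = id_blinfun" by (simp add: T cesaro_sum_0 \<open>\<alpha> > 0\<close>)
  \<comment> \<open>For \<open>n = 0\<close>, truncated subtraction would give \<open>{0}\<close>
    instead of the empty set.\<close>
  have "{0..n-1} = {..<n}" if "n \<ge> 1" for n :: nat using that by auto
  then show "S 0 = id_blinfun \<and>
     (\<forall>n\<ge>1. \<forall>m. S n o\<^sub>L S m =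
        (\<Sum>u=m..n+m. cesaro_kernel \<alpha> (n + m - u) *\<^sub>R S u)
        - (\<Sum>u=0..n-1. cesaro_kernel \<alpha> (n + m - u) *\<^sub>R S u))"
    using compose_of_recursion[of "cesaro_kernel \<alpha>" S T] S0 \<open>\<alpha> > 0\<close>
    by (simp add: T cesaro_sum_Suc)
next
  assume R: "S 0 = id_blinfun \<and>
     (\<forall>n\<ge>1. \<forall>m. S n o\<^sub>L S m =
        (\<Sum>u=m..n+m. cesaro_kernel \<alpha> (n + m - u) *\<^sub>R S u)
        - (\<Sum>u=0..n-1. cesaro_kernel \<alpha> (n + m - u) *\<^sub>R S u))"
  \<comment> \<open>The only candidate, since the Cesaro sum of \<open>T\<close> at index 1 is
    \<open>T\<close> plus \<open>cesaro_kernel \<alpha> 1\<close> times the identity.\<close>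
  define T where "T = S 1 - cesaro_kernel \<alpha> 1 *\<^sub>R id_blinfun"
  have "S (Suc m) = (T o\<^sub>L S m) + cesaro_kernel \<alpha> (Suc m) *\<^sub>R id_blinfun" for m
  proof -
    \<comment> \<open>At \<open>n = 1\<close> the first sum has only the terms \<open>u = m\<close>
      and \<open>u = Suc m\<close>, the latter with weight 1; the second has only
      \<open>u = 0\<close>.\<close>
    have "S 1 o\<^sub>L S m = cesaro_kernel \<alpha> 1 *\<^sub>R S m + S (Suc m)
        - cesaro_kernel \<alpha> (Suc m) *\<^sub>R id_blinfun"
      using R \<open>\<alpha> > 0\<close> by simp
    then show ?thesis
      by (simp add: T_def blinfun_compose.diff_left blinfun_compose.scaleR_left)
  qed
  then have "\<forall>n. S n = cesaro_sum \<alpha> T n"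
    using R \<open>\<alpha> > 0\<close> cesaro_sum_unique by blast
  moreover have "T \<in> bounded_ops"
    unfolding T_def by (rule bounded_ops_diff_scaleR_id) (rule assms(2))
  ultimately show "\<exists>T \<in> bounded_ops. \<forall>n. S n = cesaro_sum \<alpha> T n" by blast
qed

end
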